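(* Let $(G,H)=(G,\cdot,H,\star,\odot)$ be a bracoid containing a brace, and let $\lambda,\rho$ be the functions defined by $\lambda_x(y)=(x\odot e)^{-\star}\star(x\odot(y\odot e))$ and $\rho_y(x)=\lambda_x(y)^{-1}xy$ for $x,y\in G$. Then the function $r:G\times G\to G\times G$ defined by $$r(x,y)=\left(\rho_{x^{-1}}(y^{-1})^{-1},\ \lambda_{y^{-1}}(x^{-1})^{-1}\right)$$ is a left nondegenerate solution of the set-theoretic Yang--Baxter equation on $G$.
   Context: Bracoid (= left skew bracoid): a quintuple $(G,\cdot,N,\star,\odot)$, abbreviated $(G,N)$, where $(G,\cdot)$ and $(N,\star)$ are groups and $\odot$ is a transitive left action of $(G,\cdot)$ on the set $N$ with $x\odot(\eta\star\mu)=(x\odot\eta)\star(x\odot e_N)^{-\star}\star(x\odot\mu)$ for all $x\in G$, $\eta,\mu\in N$ (here $^{-\star}$ is inversion with respect to $\star$). It contains a brace if there is a subgroup $H$ of $(G,\cdot)$ such that the restricted action makes $(H,N)$ a bracoid with $\mathrm{Stab}_H(e_N)$ trivial (equivalently, $H$ acts regularly on $N$). Convention: a bracoid containing a brace is written $(G,\cdot,H,\star,\odot)$ with $H\le(G,\cdot)$ the subgroup in that definition, the additive group having been identified with $H$ through $h\mapsto h\odot e_N$. Thus the identity $e$ of $G$ is also the identity of $(H,\star)$, and $h\odot e=h$ for all $h\in H$ (hence $h\odot k=hk$ for $h,k\in H$). In terms of the homomorphism $\gamma:G\to\mathrm{Aut}(H,\star)$, $\gamma_x(h)=(x\odot e)^{-\star}\star(x\odot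 h)$, one has $\lambda_x(y)=\gamma_x(y\odot e)\in H\subseteq G$. Products written by juxtaposition and inverses $^{-1}$ are taken in $(G,\cdot)$. A solution of the set-theoretic Yang--Baxter equation on a nonempty set $G$ is a map $r:G\times G\to G\times G$ with $(r\times\mathrm{id})(\mathrm{id}\times r)(r\times\mathrm{id})=(\mathrm{id}\times r)(r\times\mathrm{id})(\mathrm{id}\times r)$ on $G\times G\times G$. A solution written $r(x,y)=(f_x(y),g_y(x))$ is left nondegenerate if $f_x:G\to G$ is bijective for each $x\in G$. *)

theory Defs
  imports "HOL-Algebra.Group_Action"
begin

text \<open>As in \<^locale>\<open>group_action\<close>, each action map is extensional, i.e. arbitrary but fixed
  outside the set acted on. Left translation by \<open>x\<close> is \<open>act x\<close>.\<close>

locale bracoid =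
  transitive_action G "carrier N" act + additive: group N
  for G :: "('a, 'm) monoid_scheme" (structure)
    and N :: "('b, 'n) monoid_scheme"
    and act :: "'a \<Rightarrow> 'b \<Rightarrow> 'b" +
  assumes act_mult:
    "\<lbrakk>x \<in> carrier G; \<eta> \<in> carrier N; \<mu> \<in> carrier N\<rbrakk> \<Longrightarrow>
      act x (\<eta> \<otimes>\<^bsub>N\<^esub> \<mu>) = act x \<eta> \<otimes>\<^bsub>N\<^esub> inv\<^bsub>N\<^esub> (act x \<one>\<^bsub>N\<^esub>) \<otimes>\<^bsub>N\<^esub> act x \<mu>"

definition contains_brace_at ::
  "('a, 'm) monoid_scheme \<Rightarrow> ('b, 'n) monoid_scheme \<Rightarrow> ('a \<Rightarrow> 'b \<Rightarrow> 'b) \<Rightarrow> 'a set \<Rightarrow> bool"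
  where
  "contains_brace_at G N act K \<longleftrightarrow>
     subgroup K G \<and>
     bracoid (G\<lparr>carrier := K\<rparr>) N act \<and>
     stabilizer (G\<lparr>carrier := K\<rparr>) act \<one>\<^bsub>N\<^esub> = {\<one>\<^bsub>G\<^esub>}"

text \<open>A bracoid containing a brace, after the additive group has been identified with the
  subgroup along \<open>h \<mapsto> act h e\<close>. The record \<open>H\<close> carries the additive operation; its carrier
  is the subgroup of \<open>G\<close>, whose multiplication is inherited from \<open>G\<close>.\<close>

locale bracoid_containing_brace =
  bracoid G H act
  for G :: "('a, 'm) monoid_scheme" (structure)
    and H :: "('a, 'n) monoid_scheme"
    and act :: "'a \<Rightarrow> 'a \<Rightarrow> 'a" +
  assumes contains_brace: "contains_brace_at G H act (carrier H)"
    and identified: "h \<in> carrier H \<Longrightarrow> act h \<one>\<^bsub>H\<^esub> = h"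
begin

lemma subgroup_H: "subgroup (carrier H) G"
  using contains_brace by (simp add: contains_brace_at_def)

lemma one_H_eq_one_G: "\<one>\<^bsub>H\<^esub> = \<one>"
proof -
  have "act \<one> \<one>\<^bsub>H\<^esub> = \<one>\<^bsub>H\<^esub>"
    using id_eq_one by (metis additive.one_closed restrict_apply')
  then show ?thesis
    using identified[OF subgroup.one_closed[OF subgroup_H]] by simp
qed

lemma act_eq_mult:
  assumes "h \<in> carrier H" "k \<in> carrier H"
  shows "act h k = h \<otimes> k"
proof -
  have "act (h \<otimes> k) \<one>\<^bsub>H\<^esub> = act h (act k \<one>\<^bsub>H\<^esub>)"
    using assms subgroup.mem_carrier[OF subgroup_H] by (intro composition_rule) auto
  then show ?thesis
    using identified assms subgroup.m_closed[OF subgroup_H] by simp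
qed

end

definition bracoid_lambda ::
  "('a, 'm) monoid_scheme \<Rightarrow> ('a, 'n) monoid_scheme \<Rightarrow> ('a \<Rightarrow> 'a \<Rightarrow> 'a) \<Rightarrow> 'a \<Rightarrow> 'a \<Rightarrow> 'a"
  where
  "bracoid_lambda G H act x y =
     inv\<^bsub>H\<^esub> (act x \<one>\<^bsub>G\<^esub>) \<otimes>\<^bsub>H\<^esub> act x (act y \<one>\<^bsub>G\<^esub>)"

text \<open>The first argument of \<open>bracoid_rho G H act\<close> is the subscript of \<open>\<rho>\<close>.\<close>

definition bracoid_rho ::
  "('a, 'm) monoid_scheme \<Rightarrow> ('a, 'n) monoid_scheme \<Rightarrow> ('a \<Rightarrow> 'a \<Rightarrow> 'a) \<Rightarrow> 'a \<Rightarrow> 'a \<Rightarrow> 'a"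
  where
  "bracoid_rho G H act y x =
     inv\<^bsub>G\<^esub> (bracoid_lambda G H act x y) \<otimes>\<^bsub>G\<^esub> x \<otimes>\<^bsub>G\<^esub> y"

definition times_id :: "('a \<times> 'a \<Rightarrow> 'a \<times> 'a) \<Rightarrow> 'a \<times> 'a \<times> 'a \<Rightarrow> 'a \<times> 'a \<times> 'a"
  where "times_id r = (\<lambda>(x, y, z). case r (x, y) of (x', y') \<Rightarrow> (x', y', z))"

definition id_times :: "('a \<times> 'a \<Rightarrow> 'a \<times> 'a) \<Rightarrow> 'a \<times> 'a \<times> 'a \<Rightarrow> 'a \<times> 'a \<times> 'a"
  where "id_times r = (\<lambda>(x, y, z). (x, r (y, z)))"

definition YBE_solution :: "'a set \<Rightarrow> ('a \<times> 'a \<Rightarrow> 'a \<times> 'a) \<Rightarrow> bool"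
  where
  "YBE_solution S r \<longleftrightarrow>
     S \<noteq> {} \<and>
     r \<in> S \<times> S \<rightarrow> S \<times> S \<and>
     (\<forall>t \<in> S \<times> S \<times> S.
        (times_id r \<circ> id_times r \<circ> times_id r) t = (id_times r \<circ> times_id r \<circ> id_times r) t)"

definition left_nondegenerate :: "'a set \<Rightarrow> ('a \<times> 'a \<Rightarrow> 'a \<times> 'a) \<Rightarrow> bool"
  where "left_nondegenerate S r \<longleftrightarrow> (\<forall>x \<in> S. bij_betw (\<lambda>y. fst (r (x, y))) S S)"

end

theory Submission
  imports Defs
begin

text \<open>
  The map \<open>r\<close> belongs to a matched pair of actions of \<open>G\<close> on itself. Write
  \<open>r (x, y) = (f x y, g y x)\<close>. If \<open>f\<close> is a left action, \<open>g\<close> a right action and the two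
  components multiply to \<open>x y\<close>, the braid equation is immediate: in the first coordinate
  both sides are the action of \<open>x y\<close> on \<open>z\<close>, in the third the action of \<open>y z\<close> on \<open>x\<close>, and the
  second coordinates agree by cancellation, since each side preserves the product \<open>x y z\<close>
  (\<open>YBE_solution_if_actions\<close>). Here an action is just a multiplicative family of maps: since \<open>\<lambda>\<close>
  takes its values in the subgroup \<open>H\<close>, its map at \<open>\<one>\<close> is a projection of \<open>G\<close> onto \<open>H\<close>
  and in general not the identity.

  The map \<open>\<gamma>\<close> is a multiplicative family of endomorphisms of the additive group, so
  \<open>\<lambda>\<close> is a left action in this sense (\<open>lambda_mult\<close>). For \<open>\<rho>\<close> to be a right action one
  needs \<open>\<lambda> x (y z) = \<lambda> x y \<cdot> \<lambda> (\<rho> y x) z\<close> (\<open>lambda_mult_right\<close>); there the point is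
  that elements of \<open>H\<close> satisfy \<open>h k = h \<star> \<gamma> h k\<close>, which turns the product on the right into
  \<open>\<lambda> x y \<star> \<lambda> (x y) z\<close>. Thus \<open>(x, y) \<mapsto> (\<lambda> x y, \<rho> y x)\<close> fits the pattern, and \<open>r\<close> is its
  conjugate under \<open>(x, y) \<mapsto> (y\<inverse>, x\<inverse>)\<close>, which interchanges left and right
  actions. The left action that results comes from \<open>\<rho>\<close>, which is unital, so its maps are
  bijections.
\<close>

section \<open>Solutions from pairs of actions of a group on itself\<close>

lemma (in group) YBE_solution_if_actions:
  assumes r: "\<And>x y. \<lbrakk>x \<in> carrier G; y \<in> carrier G\<rbrakk> \<Longrightarrow> r (x, y) = (f x y, g y x)"
    and f_closed: "\<And>x y. \<lbrakk>x \<in> carrier G; y \<in> carrier G\<rbrakk> \<Longrightarrow> f x y \<in> carrier G"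
    and g_closed: "\<And>x y. \<lbrakk>x \<in> carrier G; y \<in> carrier G\<rbrakk> \<Longrightarrow> g y x \<in> carrier G"
    and f_mult: "\<And>x y z. \<lbrakk>x \<in> carrier G; y \<in> carrier G; z \<in> carrier G\<rbrakk> \<Longrightarrow>
      f (x \<otimes> y) z = f x (f y z)"
    and g_mult: "\<And>x y z. \<lbrakk>x \<in> carrier G; y \<in> carrier G; z \<in> carrier G\<rbrakk> \<Longrightarrow>
      g (y \<otimes> z) x = g z (g y x)"
    and fg: "\<And>x y. \<lbrakk>x \<in> carrier G; y \<in> carrier G\<rbrakk> \<Longrightarrow> f x y \<otimes> g y x = x \<otimes> y"
  shows "YBE_solution (carrier G) r"
proof -
  have "(times_id r \<circ> id_times r \<circ> times_id r) (x, y, z) =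
      (id_times r \<circ> times_id r \<circ> id_times r) (x, y, z)"
    if x: "x \<in> carrier G" and y: "y \<in> carrier G" and z: "z \<in> carrier G" for x y z
  proof -
    note closed = x y z f_closed g_closed
    define a b c where "a = f (f x y) (f (g y x) z)"
      and "b = g (f (g y x) z) (f x y)" and "c = g z (g y x)"
    define a' b' c' where "a' = f x (f y z)"
      and "b' = f (g (f y z) x) (g z y)" and "c' = g (g z y) (g (f y z) x)"
    have in_G: "a \<in> carrier G" "b \<in> carrier G" "c \<in> carrier G" "b' \<in> carrier G"
      unfolding a_def b_def c_def b'_def by (simp_all add: closed)
    have "a = f (f x y \<otimes> g y x) z"
      unfolding a_def by (simp add: f_mult closed)
    then have a: "a = a'"
      by (simp add: fg a'_def f_mult closed)
    have "c' = g (f y z \<otimes> g z y) x"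
      unfolding c'_def by (simp add: g_mult closed)
    then have c: "c = c'"
      by (simp add: fg c_def g_mult closed)
    have "a \<otimes> b \<otimes> c = f x y \<otimes> (f (g y x) z \<otimes> g z (g y x))"
      unfolding a_def b_def c_def by (simp add: fg m_assoc closed)
    also have "\<dots> = x \<otimes> y \<otimes> z"
      by (simp add: fg m_assoc[symmetric] closed)
    finally have left: "a \<otimes> b \<otimes> c = x \<otimes> y \<otimes> z" .
    have "a' \<otimes> b' \<otimes> c' = f x (f y z) \<otimes> (b' \<otimes> c')"
      unfolding a'_def b'_def c'_def by (simp add: m_assoc closed)
    also have "\<dots> = f x (f y z) \<otimes> g (f y z) x \<otimes> g z y"
      unfolding b'_def c'_def by (simp add: fg m_assoc[symmetric] closed)
    also have "\<dots> = x \<otimes> y \<otimes> z"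
      by (simp add: fg m_assoc closed)
    finally have "a \<otimes> b' \<otimes> c = a \<otimes> b \<otimes> c"
      using left a c by simp
    then have b: "b = b'"
      using in_G by simp
    have "(times_id r \<circ> id_times r \<circ> times_id r) (x, y, z) = (a, b, c)"
      by (simp add: times_id_def id_times_def r closed a_def b_def c_def)
    moreover have "(id_times r \<circ> times_id r \<circ> id_times r) (x, y, z) = (a', b', c')"
      by (simp add: times_id_def id_times_def r closed a'_def b'_def c'_def)
    ultimately show ?thesis
      using a b c by simp
  qed
  then show ?thesis
    unfolding YBE_solution_def using r f_closed g_closed one_closed by auto
qed

lemma (in group) left_nondegenerate_if_action:
  assumes r: "\<And>x y. \<lbrakk>x \<in> carrier G; y \<in> carrier G\<rbrakk> \<Longrightarrow> fst (r (x, y)) = f x y"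
    and f_closed: "\<And>x y. \<lbrakk>x \<in> carrier G; y \<in> carrier G\<rbrakk> \<Longrightarrow> f x y \<in> carrier G"
    and f_mult: "\<And>x y z. \<lbrakk>x \<in> carrier G; y \<in> carrier G; z \<in> carrier G\<rbrakk> \<Longrightarrow>
      f (x \<otimes> y) z = f x (f y z)"
    and f_one: "\<And>y. y \<in> carrier G \<Longrightarrow> f \<one> y = y"
  shows "left_nondegenerate (carrier G) r"
  unfolding left_nondegenerate_def
proof
  fix x
  assume x: "x \<in> carrier G"
  have "bij_betw (f x) (carrier G) (carrier G)"
    by (rule bij_betw_byWitness[where f' = "f (inv x)"])
      (auto simp: x f_closed f_one simp flip: f_mult)
  then show "bij_betw (\<lambda>y. fst (r (x, y))) (carrier G) (carrier G)"
    using bij_betw_cong[of "carrier G" "f x" "\<lambda>y. fst (r (x, y))"] r x by simp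
qed

section \<open>The gamma maps of a bracoid\<close>

context bracoid
begin

definition gamma :: "'a \<Rightarrow> 'b \<Rightarrow> 'b"
  where "gamma x \<eta> = inv\<^bsub>N\<^esub> (act x \<one>\<^bsub>N\<^esub>) \<otimes>\<^bsub>N\<^esub> act x \<eta>"

lemma act_closed: "\<lbrakk>x \<in> carrier G; \<eta> \<in> carrier N\<rbrakk> \<Longrightarrow> act x \<eta> \<in> carrier N"
  using element_image by blast

lemma gamma_closed: "\<lbrakk>x \<in> carrier G; \<eta> \<in> carrier N\<rbrakk> \<Longrightarrow> gamma x \<eta> \<in> carrier N"
  by (simp add: gamma_def act_closed)

lemma gamma_one_right: "x \<in> carrier G \<Longrightarrow> gamma x \<one>\<^bsub>N\<^esub> = \<one>\<^bsub>N\<^esub>"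
  by (simp add: gamma_def act_closed)

lemma act_eq_gamma:
  "\<lbrakk>x \<in> carrier G; \<eta> \<in> carrier N\<rbrakk> \<Longrightarrow> act x \<eta> = act x \<one>\<^bsub>N\<^esub> \<otimes>\<^bsub>N\<^esub> gamma x \<eta>"
  by (simp add: gamma_def act_closed additive.m_assoc[symmetric])

lemma gamma_add:
  assumes "x \<in> carrier G" "\<eta> \<in> carrier N" "\<mu> \<in> carrier N"
  shows "gamma x (\<eta> \<otimes>\<^bsub>N\<^esub> \<mu>) = gamma x \<eta> \<otimes>\<^bsub>N\<^esub> gamma x \<mu>"
  using assms by (simp add: gamma_def act_mult act_closed additive.m_assoc)

lemma act_mult_left:
  "\<lbrakk>x \<in> carrier G; y \<in> carrier G; \<eta> \<in> carrier N\<rbrakk> \<Longrightarrow> act (x \<otimes> y) \<eta> = act x (act y \<eta>)"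
  by (rule composition_rule) auto

lemma gamma_mult:
  assumes x: "x \<in> carrier G" and y: "y \<in> carrier G" and \<eta>: "\<eta> \<in> carrier N"
  shows "gamma (x \<otimes> y) \<eta> = gamma x (gamma y \<eta>)"
proof -
  have G: "group G"
    using group_hom group_hom.axioms(1) by blast
  have xy: "x \<otimes> y \<in> carrier G"
    using G x y by (simp add: group.is_monoid monoid.m_closed)
  have one: "\<one>\<^bsub>N\<^esub> \<in> carrier N"
    by simp
  have "act (x \<otimes> y) \<eta> = act x \<one>\<^bsub>N\<^esub> \<otimes>\<^bsub>N\<^esub> gamma x (act y \<one>\<^bsub>N\<^esub> \<otimes>\<^bsub>N\<^esub> gamma y \<eta>)"
    using x y \<eta> by (metis act_mult_left act_eq_gamma act_closed)
  also have "\<dots> = act x (act y \<one>\<^bsub>N\<^esub>) \<otimes>\<^bsub>N\<^esub> gamma x (gamma y \<eta>)"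
    using x y \<eta>
    by (simp add: gamma_add gamma_closed act_closed additive.m_assoc
        act_eq_gamma[of x "act y \<one>\<^bsub>N\<^esub>"])
  also have "\<dots> = act (x \<otimes> y) \<one>\<^bsub>N\<^esub> \<otimes>\<^bsub>N\<^esub> gamma x (gamma y \<eta>)"
    using x y one by (simp add: act_mult_left)
  finally have "act (x \<otimes> y) \<eta> = \<dots>" .
  then have "act (x \<otimes> y) \<one>\<^bsub>N\<^esub> \<otimes>\<^bsub>N\<^esub> gamma (x \<otimes> y) \<eta> =
      act (x \<otimes> y) \<one>\<^bsub>N\<^esub> \<otimes>\<^bsub>N\<^esub> gamma x (gamma y \<eta>)"
    using act_eq_gamma[OF xy \<eta>] by simp
  then show ?thesis
    using x y \<eta> xy by (simp add: gamma_closed act_closed)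
qed

end

section \<open>The lambda and rho maps\<close>

context bracoid_containing_brace
begin

abbreviation lam :: "'a \<Rightarrow> 'a \<Rightarrow> 'a"
  where "lam \<equiv> bracoid_lambda G H act"

abbreviation rho :: "'a \<Rightarrow> 'a \<Rightarrow> 'a"
  where "rho \<equiv> bracoid_rho G H act"

sublocale multiplicative: group G
  using group_hom group_hom.axioms(1) by blast

lemma lambda_eq_gamma: "lam x y = gamma x (act y \<one>\<^bsub>H\<^esub>)"
  by (simp add: bracoid_lambda_def gamma_def one_H_eq_one_G)

lemma lambda_in_H: "\<lbrakk>x \<in> carrier G; y \<in> carrier G\<rbrakk> \<Longrightarrow> lam x y \<in> carrier H"
  by (simp add: lambda_eq_gamma gamma_closed act_closed)

lemma lambda_closed: "\<lbrakk>x \<in> carrier G; y \<in> carrier G\<rbrakk> \<Longrightarrow> lam x y \<in> carrier G"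
  using lambda_in_H subgroup.mem_carrier[OF subgroup_H] by blast

lemma rho_closed: "\<lbrakk>x \<in> carrier G; y \<in> carrier G\<rbrakk> \<Longrightarrow> rho y x \<in> carrier G"
  by (simp add: bracoid_rho_def lambda_closed)

lemma lambda_rho: "\<lbrakk>x \<in> carrier G; y \<in> carrier G\<rbrakk> \<Longrightarrow> lam x y \<otimes> rho y x = x \<otimes> y"
  by (simp add: bracoid_rho_def lambda_closed multiplicative.m_assoc[symmetric])

text \<open>A value of \<open>\<lambda>\<close> lies in \<open>H\<close>, hence is recovered from its action on the identity. This
  is what makes the composition of two \<open>\<lambda>\<close>'s a composition of two \<open>\<gamma>\<close>'s.\<close>

lemma lambda_mult:
  assumes "x \<in> carrier G" "y \<in> carrier G" "z \<in> carrier G"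
  shows "lam (x \<otimes> y) z = lam x (lam y z)"
proof -
  have "act (lam y z) \<one>\<^bsub>H\<^esub> = lam y z"
    using assms by (simp add: identified lambda_in_H)
  then show ?thesis
    using assms by (simp add: lambda_eq_gamma gamma_mult act_closed)
qed

text \<open>The cocycle identity for the map \<open>x \<mapsto> act x e\<close> from \<open>G\<close> to the additive group; for
  elements of \<open>H\<close> it expresses their product through \<open>\<star>\<close>.\<close>

lemma act_mult_one:
  assumes "x \<in> carrier G" "y \<in> carrier G"
  shows "act (x \<otimes> y) \<one>\<^bsub>H\<^esub> = act x \<one>\<^bsub>H\<^esub> \<otimes>\<^bsub>H\<^esub> lam x y"
  using assms act_eq_gamma[of x "act y \<one>\<^bsub>H\<^esub>"]
  by (simp add: act_mult_left lambda_eq_gamma act_closed)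

text \<open>Both sides equal \<open>\<lambda> x y \<star> \<lambda> (x y) z\<close>: on the left because \<open>\<gamma> x\<close> is additive, on
  the right because \<open>\<lambda> x y\<close> and \<open>\<rho> y x\<close> multiply to \<open>x y\<close>.\<close>

lemma lambda_mult_right:
  assumes x: "x \<in> carrier G" and y: "y \<in> carrier G" and z: "z \<in> carrier G"
  shows "lam x (y \<otimes> z) = lam x y \<otimes> lam (rho y x) z"
proof -
  let ?h = "lam x y" and ?k = "lam (rho y x) z"
  have h: "?h \<in> carrier H" "?h \<in> carrier G" and k: "?k \<in> carrier H" "?k \<in> carrier G"
    using x y z by (simp_all add: lambda_in_H lambda_closed rho_closed)
  have "lam x (y \<otimes> z) = gamma x (act y \<one>\<^bsub>H\<^esub> \<otimes>\<^bsub>H\<^esub> lam y z)"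
    using y z by (simp add: lambda_eq_gamma[of x] act_mult_one)
  also have "\<dots> = ?h \<otimes>\<^bsub>H\<^esub> gamma x (lam y z)"
    using x y z by (simp add: gamma_add lambda_in_H act_closed lambda_eq_gamma[of x])
  also have "\<dots> = ?h \<otimes>\<^bsub>H\<^esub> lam x (lam y z)"
    using x y z by (simp add: lambda_eq_gamma[of x] identified lambda_in_H)
  also have "lam x (lam y z) = lam (?h \<otimes> rho y x) z"
    using x y z by (simp add: lambda_rho lambda_mult)
  also have "\<dots> = lam ?h ?k"
    using x y z h by (simp add: lambda_mult rho_closed)
  also have "?h \<otimes>\<^bsub>H\<^esub> lam ?h ?k = act (?h \<otimes> ?k) \<one>\<^bsub>H\<^esub>"
    using h k by (simp add: act_mult_one identified)
  also have "\<dots> = ?h \<otimes> ?k"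
    using h k subgroup.m_closed[OF subgroup_H] by (simp add: identified)
  finally show ?thesis .
qed

lemma rho_mult:
  assumes "x \<in> carrier G" "y \<in> carrier G" "z \<in> carrier G"
  shows "rho (y \<otimes> z) x = rho z (rho y x)"
proof -
  have "rho (y \<otimes> z) x = inv (lam x y \<otimes> lam (rho y x) z) \<otimes> (x \<otimes> y \<otimes> z)"
    using assms
    by (simp add: bracoid_rho_def[of _ _ _ "y \<otimes> z"] lambda_mult_right lambda_closed rho_closed
        multiplicative.m_assoc)
  also have "\<dots> = inv (lam (rho y x) z) \<otimes> (inv (lam x y) \<otimes> x \<otimes> y) \<otimes> z"
    using assms
    by (simp add: multiplicative.inv_mult_group lambda_closed rho_closed multiplicative.m_assoc)
  also have "\<dots> = rho z (rho y x)"
    by (simp add: bracoid_rho_def)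
  finally show ?thesis .
qed

lemma rho_one:
  assumes "x \<in> carrier G"
  shows "rho \<one> x = x"
proof -
  have "act \<one> \<one>\<^bsub>H\<^esub> = \<one>\<^bsub>H\<^esub>"
    using identified[OF additive.one_closed] by (simp add: one_H_eq_one_G)
  then have "lam x \<one> = \<one>"
    using assms gamma_one_right one_H_eq_one_G by (simp add: lambda_eq_gamma)
  then show ?thesis
    using assms by (simp add: bracoid_rho_def)
qed

end

section \<open>The left nondegenerate solution\<close>

theorem proposition4p1:
  fixes G :: "('a, 'm) monoid_scheme"
    and H :: "('a, 'n) monoid_scheme"
    and act :: "'a \<Rightarrow> 'a \<Rightarrow> 'a"
    and r :: "'a \<times> 'a \<Rightarrow> 'a \<times> 'a"
  assumes "bracoid_containing_brace G H act"
    and "\<And>x y. \<lbrakk>x \<in> carrier G; y \<in> carrier G\<rbrakk> \<Longrightarrow>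
      r (x, y) =
        (inv\<^bsub>G\<^esub> (bracoid_rho G H act (inv\<^bsub>G\<^esub> x) (inv\<^bsub>G\<^esub> y)),
         inv\<^bsub>G\<^esub> (bracoid_lambda G H act (inv\<^bsub>G\<^esub> y) (inv\<^bsub>G\<^esub> x)))"
  shows "YBE_solution (carrier G) r \<and> left_nondegenerate (carrier G) r"
proof -
  interpret bracoid_containing_brace G H act
    by fact
  define f where "f x y = inv\<^bsub>G\<^esub> (rho (inv\<^bsub>G\<^esub> x) (inv\<^bsub>G\<^esub> y))" for x y
  define g where "g y x = inv\<^bsub>G\<^esub> (lam (inv\<^bsub>G\<^esub> y) (inv\<^bsub>G\<^esub> x))" for x y
  have r: "r (x, y) = (f x y, g y x)" if "x \<in> carrier G" "y \<in> carrier G" for x y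
    using that assms(2) by (simp add: f_def g_def)
  have f_closed: "f x y \<in> carrier G" if "x \<in> carrier G" "y \<in> carrier G" for x y
    using that by (simp add: f_def rho_closed)
  have g_closed: "g y x \<in> carrier G" if "x \<in> carrier G" "y \<in> carrier G" for x y
    using that by (simp add: g_def lambda_closed)
  have f_mult: "f (x \<otimes>\<^bsub>G\<^esub> y) z = f x (f y z)"
    if "x \<in> carrier G" "y \<in> carrier G" "z \<in> carrier G" for x y z
    using that by (simp add: f_def multiplicative.inv_mult_group rho_mult rho_closed)
  have g_mult: "g (y \<otimes>\<^bsub>G\<^esub> z) x = g z (g y x)"
    if "x \<in> carrier G" "y \<in> carrier G" "z \<in> carrier G" for x y z
    using that by (simp add: g_def multiplicative.inv_mult_group lambda_mult lambda_closed)
  have fg: "f x y \<otimes>\<^bsub>G\<^esub> g y x = x \<otimes>\<^bsub>G\<^esub> y"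
    if x: "x \<in> carrier G" and y: "y \<in> carrier G" for x y
  proof -
    have "f x y \<otimes>\<^bsub>G\<^esub> g y x =
        inv\<^bsub>G\<^esub> (lam (inv\<^bsub>G\<^esub> y) (inv\<^bsub>G\<^esub> x) \<otimes>\<^bsub>G\<^esub> rho (inv\<^bsub>G\<^esub> x) (inv\<^bsub>G\<^esub> y))"
      using x y by (simp add: f_def g_def multiplicative.inv_mult_group lambda_closed rho_closed)
    then show ?thesis
      using x y by (simp add: lambda_rho multiplicative.inv_mult_group)
  qed
  have f_one: "f \<one>\<^bsub>G\<^esub> y = y" if "y \<in> carrier G" for y
    using that by (simp add: f_def rho_one)
  show ?thesis
    using multiplicative.YBE_solution_if_actions[of r f g, OF r f_closed g_closed f_mult g_mult fg]
      multiplicative.left_nondegenerate_if_action[of r f, OF _ f_closed f_mult f_one] r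
    by simp
qed

end
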